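(* Let $k\ge 3$ be an integer. If $n=2^s k-2^{s+1}+2$ for some integer $s>0$, then $$\Delta_k(n)\le \Delta_k'(n)\le \frac{1}{2^s} = \frac{k-2}{n-2}.$$
   Context: For an integer $k\ge 3$, an integer $n\ge k$ and a set $\mathcal{P}$ of $n$ points in the unit square $[0,1]^2$, let $\mathcal{A}_k(\mathcal{P})$ be the minimum, over all $k$-element subsets of $\mathcal{P}$, of the area of the convex hull of that subset; $\Delta_k(n)$ is the supremum of $\mathcal{A}_k(\mathcal{P})$ over all $n$-point sets $\mathcal{P}\subset[0,1]^2$. Similarly, for $0<d\le 1$ and a set $\mathcal{P}$ of $n$ points in the rectangle $[0,d]\times[0,d^{-1}]$ (of area $1$), let $\mathcal{A}'_k(\mathcal{P})$ be the minimum area of the convex hull of a $k$-element subset of $\mathcal{P}$, and let $\Delta_k'(n)$ be the supremum of $\mathcal{A}'_k(\mathcal{P})$ over all $0<d\le1$ and all $n$-point sets $\mathcal{P}\subset[0,d]\times[0,d^{-1}]$. *)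

theory Defs
  imports "HOL-Analysis.Analysis"
begin

(* Points of the plane are elements of real \<times> real, and area is two-dimensional Lebesgue measure.
   For a finite P with card P \<ge> k \<ge> 1 the Min below ranges over a finite nonempty set. *)

definition min_hull_area :: "nat \<Rightarrow> (real \<times> real) set \<Rightarrow> real" where
  "min_hull_area k P = Min {measure lborel (convex hull S) | S. S \<subseteq> P \<and> card S = k}"

(* For n \<ge> k \<ge> 1 both suprema below are over nonempty sets of reals that are bounded above
   by 1, the area of the square and of each rectangle, so they are genuine suprema. *)

definition Delta :: "nat \<Rightarrow> nat \<Rightarrow> real" where
  "Delta k n = Sup {min_hull_area k P | P.
     finite P \<and> card P = n \<and> P \<subseteq> {0..1} \<times> {0..1}}"

definition Delta' :: "nat \<Rightarrow> nat \<Rightarrow> real" where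
  "Delta' k n = Sup {min_hull_area k P | d P.
     0 < d \<and> d \<le> 1 \<and> finite P \<and> card P = n \<and> P \<subseteq> {0..d} \<times> {0..inverse d}}"

end

theory Submission
  imports Defs
begin

text \<open>
  Write \<open>n = 2 ^ s * j + 2\<close> with \<open>j = k - 2\<close> and halve repeatedly. Take the lexicographically least
  point \<open>p\<close> of the set; the remaining points have a linear angular order around \<open>p\<close>, and their
  number is odd, so there is a median \<open>q\<close>. Each closed side of the line \<open>p q\<close> then carries
  \<open>2 ^ (s - 1) * j + 2\<close> of the points, both \<open>p\<close> and \<open>q\<close> being counted on each side. The two
  convex hulls overlap in a null set, so one of them has at most half of the area. Collinear
  points do no harm, as ties in the angular order may be broken arbitrarily.
\<close>

text \<open>Selects the element of rank \<open>a\<close> in the order given by \<open>f\<close>: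
  each induction step removes one minimum of \<open>f\<close> and hands it to \<open>B\<close>. The
  weak inequalities allow \<open>f\<close> to take equal values, and the cardinalities force
  \<open>B\<close> and \<open>C\<close> to be disjoint.\<close>

lemma split_by_rank:
  fixes f :: "'a \<Rightarrow> 'b::linorder"
  assumes "finite A" "card A = a + b + 1"
  shows "\<exists>q B C. A = insert q (B \<union> C) \<and> q \<notin> B \<and> q \<notin> C \<and> card B = a \<and> card C = b
    \<and> (\<forall>x\<in>B. f x \<le> f q) \<and> (\<forall>x\<in>C. f q \<le> f x)"
  using assms
proof (induction a arbitrary: A)
  case 0
  then have "A \<noteq> {}" by auto
  then obtain q where q: "q \<in> A" "\<forall>x\<in>A. f q \<le> f x"
    using 0 arg_min_if_finite(1)[of A f] arg_min_least[of A _ f] by blast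
  show ?case
    using q 0 by (intro exI[of _ q] exI[of _ "{}"] exI[of _ "A - {q}"]) auto
next
  case (Suc a)
  then have "A \<noteq> {}" by auto
  then obtain m where m: "m \<in> A" "\<forall>x\<in>A. f m \<le> f x"
    using Suc.prems arg_min_if_finite(1)[of A f] arg_min_least[of A _ f] by blast
  obtain q B C where IH: "A - {m} = insert q (B \<union> C)" "q \<notin> B" "q \<notin> C" "card B = a" "card C = b"
    "\<forall>x\<in>B. f x \<le> f q" "\<forall>x\<in>C. f q \<le> f x"
    using Suc.IH[of "A - {m}"] Suc.prems m by auto
  have fin: "finite B" and mB: "m \<notin> B" "m \<noteq> q" and qA: "q \<in> A"
    using IH(1) Suc.prems(1) by (auto dest: finite_subset[rotated, of _ B])
  have "A = insert q (insert m B \<union> C)" using IH(1) m(1) by auto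
  moreover have "q \<notin> insert m B" "card (insert m B) = Suc a" using IH(2,4) fin mB by auto
  moreover have "\<forall>x\<in>insert m B. f x \<le> f q" using IH(6) m(2) qA by simp
  ultimately show ?case using IH(3,5,7) by blast
qed

text \<open>The quotient is the second coordinate of the radial projection of (x, y) to the unit
  circle of the l1 norm, so it grows with the angle from just past straight down to straight up.
  Clearing denominators bounds the cross product by y' |y| - y |y'|, which is 0 for equal signs and
  2 y y' if y \<ge> 0 \<ge> y'; the remaining case follows from the signs alone.\<close>

lemma cross_nonpos_if_slope_le:
  fixes x y x' y' :: real
  assumes "x \<ge> 0" "x' \<ge> 0" "x = 0 \<longrightarrow> y > 0" "x' = 0 \<longrightarrow> y' > 0"
    and le: "y / (x + \<bar>y\<bar>) \<le> y' / (x' + \<bar>y'\<bar>)"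
  shows "y * x' - x * y' \<le> 0"
proof -
  have pos: "x + \<bar>y\<bar> > 0" "x' + \<bar>y'\<bar> > 0" using assms(1-4) by linarith+
  have *: "y * (x' + \<bar>y'\<bar>) \<le> y' * (x + \<bar>y\<bar>)"
    using le pos by (simp add: field_simps)
  consider "y \<ge> 0" "y' \<ge> 0" | "y \<le> 0" "y' \<le> 0" | "y \<le> 0" "y' \<ge> 0" | "y \<ge> 0" "y' \<le> 0"
    by linarith
  then show ?thesis
  proof cases
    case 3
    then show ?thesis using assms mult_nonpos_nonneg[of y x'] mult_nonneg_nonneg[of x y'] by linarith
  next
    case 4
    then have "y * y' \<le> 0" by (simp add: mult_nonneg_nonpos)
    then show ?thesis using * 4 by (simp add: algebra_simps)
  qed (use * in \<open>simp_all add: algebra_simps\<close>)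
qed

lemma ex_lex_min:
  fixes P :: "('a::linorder \<times> 'b::linorder) set"
  assumes "finite P" "P \<noteq> {}"
  obtains p where "p \<in> P" "\<And>z. z \<in> P \<Longrightarrow> fst p \<le> fst z"
    "\<And>z. z \<in> P \<Longrightarrow> fst z = fst p \<Longrightarrow> snd p \<le> snd z"
proof -
  define Q where "Q = {z \<in> P. fst z = Min (fst ` P)}"
  have "Min (fst ` P) \<in> fst ` P" using assms by simp
  then have Q: "finite Q" "Q \<noteq> {}"
    using assms(1) unfolding Q_def by (simp, force)
  then have "Min (snd ` Q) \<in> snd ` Q" by simp
  then obtain p where p: "p \<in> Q" "snd p = Min (snd ` Q)" by force
  show thesis
  proof (rule that[of p])
    show "p \<in> P" using p by (simp add: Q_def)
    show "fst p \<le> fst z" if "z \<in> P" for z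
      using p that assms by (simp add: Q_def)
    show "snd p \<le> snd z" if "z \<in> P" "fst z = fst p" for z
      using p that Q by (simp add: Q_def)
  qed
qed

lemma compact_hull_finite:
  fixes S :: "'a::euclidean_space set"
  assumes "finite S"
  shows "compact (convex hull S)"
  using assms by (simp add: finite_imp_compact compact_convex_hull)

lemma measure_hull_mono:
  fixes S :: "'a::euclidean_space set"
  assumes "finite S" "convex hull S \<subseteq> T" "compact T"
  shows "measure lborel (convex hull S) \<le> measure lborel T"
  using assms compact_hull_finite[OF assms(1)]
  by (intro measure_mono_fmeasurable) (auto intro: fmeasurable_compact borel_compact)

text \<open>The hulls lie in opposite closed half-spaces, so they meet only inside the bounding
  hyperplane, and the measure of their union is the sum of their measures.\<close>

lemma measure_hulls_opposite_sides:
  fixes S T P :: "'a::euclidean_space set"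
  assumes "finite P" "S \<subseteq> P" "T \<subseteq> P" "a \<noteq> 0"
    and S: "\<And>x. x \<in> S \<Longrightarrow> a \<bullet> x \<le> b" and T: "\<And>x. x \<in> T \<Longrightarrow> a \<bullet> x \<ge> b"
  shows "measure lborel (convex hull S) + measure lborel (convex hull T)
    \<le> measure lborel (convex hull P)"
proof -
  have fin: "finite S" "finite T" using assms finite_subset by blast+
  have fm: "convex hull X \<in> fmeasurable lborel" if "finite X" for X :: "'a set"
    using fmeasurable_compact[OF compact_hull_finite[OF that]] .
  have "convex hull S \<subseteq> {x. a \<bullet> x \<le> b}"
    using S by (intro hull_minimal) (auto simp: convex_halfspace_le)
  moreover have "convex hull T \<subseteq> {x. a \<bullet> x \<ge> b}"
    using T by (intro hull_minimal) (auto simp: convex_halfspace_ge)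
  ultimately have "convex hull S \<inter> convex hull T \<subseteq> {x. a \<bullet> x = b}" by force
  then have "negligible (convex hull S \<inter> convex hull T)"
    using negligible_hyperplane[of a b] \<open>a \<noteq> 0\<close> negligible_subset by blast
  \<comment> \<open>Negligibility concerns \<open>lebesgue\<close>, the completion of
    \<open>lborel\<close>; both measures agree on this intersection because it is Borel.\<close>
  then have "measure lebesgue (convex hull S \<inter> convex hull T) = 0"
    by (rule negligible_imp_measure0)
  moreover have "convex hull S \<inter> convex hull T \<in> sets lborel"
    using fm[OF fin(1), THEN fmeasurableD] fm[OF fin(2), THEN fmeasurableD] by (rule sets.Int)
  ultimately have 0: "measure lborel (convex hull S \<inter> convex hull T) = 0"
    by (simp add: measure_completion)
  have "measure lborel (convex hull S \<union> convex hull T)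
      = measure lborel (convex hull S) + measure lborel (convex hull T)"
    using measure_Un3[OF fm[OF fin(1)] fm[OF fin(2)]] 0 by simp
  moreover have "measure lborel (convex hull S \<union> convex hull T) \<le> measure lborel (convex hull P)"
  proof (rule measure_mono_fmeasurable)
    show "convex hull S \<union> convex hull T \<subseteq> convex hull P"
      using assms(2,3) by (simp add: hull_mono)
    show "convex hull S \<union> convex hull T \<in> sets lborel"
      using fm[OF fin(1), THEN fmeasurableD] fm[OF fin(2), THEN fmeasurableD] by (rule sets.Un)
  qed (use fm assms(1) in blast)
  ultimately show ?thesis by simp
qed

lemma halve_point_set:
  fixes P :: "(real \<times> real) set"
  assumes "finite P" "card P = 2 * i + 2"
  obtains S where "S \<subseteq> P" "card S = i + 2"
    "2 * measure lborel (convex hull S) \<le> measure lborel (convex hull P)"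
proof -
  have "P \<noteq> {}" using assms by auto
  then obtain p where p: "p \<in> P" and p1: "\<And>z. z \<in> P \<Longrightarrow> fst p \<le> fst z"
    and p2: "\<And>z. z \<in> P \<Longrightarrow> fst z = fst p \<Longrightarrow> snd p \<le> snd z"
    using ex_lex_min[OF assms(1)] by blast
  define X where "X z = fst z - fst p" for z :: "real \<times> real"
  define Y where "Y z = snd z - snd p" for z :: "real \<times> real"
  \<comment> \<open>an increasing function of the angle that, unlike \<open>Y z / X z\<close>, is also defined on the
    vertical direction\<close>
  define f where "f z = Y z / (X z + \<bar>Y z\<bar>)" for z
  \<comment> \<open>Breaking ties of \<open>fst\<close> by \<open>snd\<close> leaves no other point
    straight below \<open>p\<close>. Hence the directions from \<open>p\<close> never wrap around
    and the denominator of \<open>f\<close> is positive.\<close>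
  have XY: "X z \<ge> 0" "X z = 0 \<longrightarrow> Y z > 0" if "z \<in> P - {p}" for z
    using that p1[of z] p2[of z] by (auto simp: X_def Y_def less_le prod_eq_iff)
  have cross: "Y z * X w - X z * Y w \<le> 0" if "z \<in> P - {p}" "w \<in> P - {p}" "f z \<le> f w" for z w
    using cross_nonpos_if_slope_le XY[OF that(1)] XY[OF that(2)] that(3) unfolding f_def by blast
  have "card (P - {p}) = i + i + 1" "finite (P - {p})" using assms p by auto
  then obtain q B C where BC: "P - {p} = insert q (B \<union> C)" "q \<notin> B" "q \<notin> C"
    "card B = i" "card C = i" "\<forall>x\<in>B. f x \<le> f q" "\<forall>x\<in>C. f q \<le> f x"
    using split_by_rank[of "P - {p}" i i f] by blast
  have qP: "q \<in> P - {p}" and BP: "B \<subseteq> P - {p}" and CP: "C \<subseteq> P - {p}" using BC(1) by auto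
  have fin: "finite B" "finite C" using BP CP assms(1) finite_subset by blast+
  \<comment> \<open>The vector from \<open>p\<close> to \<open>q\<close> turned by a quarter, hence
    normal to the line through them. Its inner product with z - p is the cross product that
    \<open>cross\<close> controls.\<close>
  define a where "a = (- Y q, X q)"
  have a0: "a \<noteq> 0" using XY[OF qP] by (auto simp: a_def zero_prod_def)
  have side: "a \<bullet> z - a \<bullet> p = Y z * X q - X z * Y q" for z
    by (cases z; cases p) (simp add: a_def X_def Y_def algebra_simps)
  let ?S = "insert p (insert q B)" and ?T = "insert p (insert q C)"
  have sub: "?S \<subseteq> P" "?T \<subseteq> P" using p qP BP CP by auto
  have card: "card ?S = i + 2" "card ?T = i + 2"
    using fin BC BP CP qP by (auto simp: card_insert_if)
  have "measure lborel (convex hull ?S) + measure lborel (convex hull ?T)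
    \<le> measure lborel (convex hull P)"
  proof (rule measure_hulls_opposite_sides[OF assms(1) sub a0])
    show "a \<bullet> z \<le> a \<bullet> p" if "z \<in> ?S" for z
    proof -
      have "Y z * X q - X z * Y q \<le> 0" if "z \<in> B"
        using that cross[of z q] BC(6) BP qP by auto
      moreover have "Y z * X q - X z * Y q = 0" if "z = p \<or> z = q"
        using that by (auto simp: X_def Y_def)
      ultimately show ?thesis using \<open>z \<in> ?S\<close> side[of z] by auto
    qed
    show "a \<bullet> z \<ge> a \<bullet> p" if "z \<in> ?T" for z
    proof -
      have "Y z * X q - X z * Y q \<ge> 0" if "z \<in> C"
        using that cross[of q z] BC(7) CP qP by (auto simp: mult.commute)
      moreover have "Y z * X q - X z * Y q = 0" if "z = p \<or> z = q"
        using that by (auto simp: X_def Y_def)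
      ultimately show ?thesis using \<open>z \<in> ?T\<close> side[of z] by auto
    qed
  qed
  then have "2 * measure lborel (convex hull ?S) \<le> measure lborel (convex hull P)
    \<or> 2 * measure lborel (convex hull ?T) \<le> measure lborel (convex hull P)"
    by linarith
  then show thesis using that sub card by blast
qed

text \<open>Both halves contain \<open>p\<close> and \<open>q\<close>, so it is the cardinality
  minus 2 that is exactly halved in each round.\<close>

lemma ex_small_hull:
  fixes P :: "(real \<times> real) set"
  assumes "finite P" "card P = 2 ^ s * j + 2"
  shows "\<exists>S\<subseteq>P. card S = j + 2
    \<and> 2 ^ s * measure lborel (convex hull S) \<le> measure lborel (convex hull P)"
  using assms
proof (induction s arbitrary: P)
  case 0
  then show ?case by auto
next
  case (Suc s)
  then obtain T where T: "T \<subseteq> P" "card T = 2 ^ s * j + 2"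
    "2 * measure lborel (convex hull T) \<le> measure lborel (convex hull P)"
    using halve_point_set[of P "2 ^ s * j"] by (auto simp: mult.assoc)
  then obtain S where S: "S \<subseteq> T" "card S = j + 2"
    "2 ^ s * measure lborel (convex hull S) \<le> measure lborel (convex hull T)"
    using Suc.IH[of T] Suc.prems(1) finite_subset by blast
  have "2 ^ Suc s * measure lborel (convex hull S) \<le> measure lborel (convex hull P)"
    using S(3) T(3) by simp
  then show ?case using S T by blast
qed

lemma min_hull_area_le:
  assumes "finite P" "S \<subseteq> P" "card S = k"
  shows "min_hull_area k P \<le> measure lborel (convex hull S)"
proof -
  have "finite {measure lborel (convex hull S) | S. S \<subseteq> P \<and> card S = k}"
    using assms(1) by simp
  then show ?thesis unfolding min_hull_area_def using assms by (intro Min_le) auto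
qed

lemma measure_rectangle:
  fixes d :: real
  assumes "d > 0"
  shows "measure lborel ({0..d} \<times> {0..inverse d}) = 1"
proof -
  have "{0..d} \<times> {0..inverse d} = cbox (0, 0) (d, inverse d)"
    by (simp add: cbox_Pair_eq)
  then show ?thesis
    using assms by (simp add: content_Pair)
qed

lemma min_hull_area_rectangle_le:
  assumes "finite P" "card P = 2 ^ s * j + 2" "d > 0" "P \<subseteq> {0..d} \<times> {0..inverse d}"
  shows "min_hull_area (j + 2) P \<le> 1 / 2 ^ s"
proof -
  obtain S where S: "S \<subseteq> P" "card S = j + 2"
    "2 ^ s * measure lborel (convex hull S) \<le> measure lborel (convex hull P)"
    using ex_small_hull[OF assms(1,2)] by blast
  \<comment> \<open>The rectangle is convex and has area 1 whatever \<open>d\<close> is, so the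
    halving starts from area at most 1.\<close>
  have "convex hull P \<subseteq> {0..d} \<times> {0..inverse d}"
    using assms(4) by (intro hull_minimal convex_Times) auto
  then have "measure lborel (convex hull P) \<le> 1"
    using measure_hull_mono[OF assms(1), of "{0..d} \<times> {0..inverse d}"]
      measure_rectangle[OF assms(3)]
    by (simp add: compact_Times)
  then have "measure lborel (convex hull S) \<le> 1 / 2 ^ s"
    using S(3) by (simp add: field_simps)
  then show ?thesis using min_hull_area_le[OF assms(1) S(1,2)] by linarith
qed

theorem theorem4:
  fixes k n s :: nat
  assumes "k \<ge> 3"
    and "s > 0"
    and "int n = 2 ^ s * int k - 2 ^ (s + 1) + 2"
  shows "Delta k n \<le> Delta' k n \<and> Delta' k n \<le> 1 / 2 ^ s
    \<and> (1 / 2 ^ s :: real) = (real k - 2) / (real n - 2)"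
proof -
  define j where "j = k - 2"
  have k: "k = j + 2" "j > 0" using assms(1) by (auto simp: j_def)
  \<comment> \<open>Substituting k = j + 2 cancels the term 2^(s+1), which gives the form that the
    halving needs.\<close>
  have "int n = int (2 ^ s * j + 2)" using assms(3) k by (simp add: algebra_simps)
  then have n: "n = 2 ^ s * j + 2" by linarith
  define D where "D = {min_hull_area k P | P. finite P \<and> card P = n \<and> P \<subseteq> {0..1} \<times> {0..1}}"
  define D' where "D' = {min_hull_area k P | d P.
     0 < d \<and> d \<le> 1 \<and> finite P \<and> card P = n \<and> P \<subseteq> {0..d} \<times> {0..inverse d}}"
  have le: "x \<le> 1 / 2 ^ s" if "x \<in> D'" for x
    using that min_hull_area_rectangle_le unfolding D'_def k(1) n by blast
  have sub: "D \<subseteq> D'"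
  proof
    fix x assume "x \<in> D"
    then obtain P where "x = min_hull_area k P" "finite P" "card P = n" "P \<subseteq> {0..1} \<times> {0..1}"
      unfolding D_def by blast
    \<comment> \<open>The unit square is the rectangle with \<open>d = 1\<close>.\<close>
    then show "x \<in> D'" unfolding D'_def
      by (intro CollectI exI[of _ 1] exI[of _ P]) auto
  qed
  \<comment> \<open>Comparing real suprema needs a nonempty \<open>D\<close>, so some set of
    \<open>n\<close> points in the square must be exhibited.\<close>
  have "infinite ({0..1::real} \<times> {0..1::real})"
    by (simp add: finite_cartesian_product_iff infinite_Icc)
  then obtain P where "finite P" "card P = n" "P \<subseteq> {0..1::real} \<times> {0..1::real}"
    using infinite_arbitrarily_large by blast
  then have ne: "D \<noteq> {}" unfolding D_def by blast
  have "bdd_above D'" using le by (rule bdd_aboveI)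
  then have "Sup D \<le> Sup D'" using ne sub by (intro cSup_subset_mono)
  moreover have "Sup D' \<le> 1 / 2 ^ s" using ne sub le by (intro cSup_least) auto
  moreover have "(1 / 2 ^ s :: real) = (real k - 2) / (real n - 2)"
    using k by (simp add: n)
  ultimately show ?thesis unfolding Delta_def Delta'_def D_def D'_def by blast
qed

end
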